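(* Let $V=(v_{ij})\in(\mathbb R\cup\{\infty\})^{d\times n}$ be a matrix none of whose columns is identically $\infty$. The union of the covector decompositions induced by the matrices $V(Z)$ on the strata $\mathbb{TP}_{\min}^{d-1}(Z)$, where $Z$ ranges over all proper subsets of $[d]$, yields a piecewise linear decomposition of the tropical projective space $\mathbb{TP}_{\min}^{d-1}$.
   Context: $\mathbb T_{\min}=\mathbb R\cup\{\infty\}$, and $\mathbf 1$ is the all-ones vector. The tropical projective space $\mathbb{TP}_{\min}^{d-1}$ is the quotient of $\mathbb T_{\min}^d\setminus\{(\infty,\dots,\infty)\}$ by $\mathbb R\mathbf 1$ (adding a real constant to all coordinates), with the quotient topology, where $\mathbb T_{\min}$ has the topology of a half-open interval. For a proper subset $Z\subsetneq[d]$ the stratum is $\mathbb{TP}_{\min}^{d-1}(Z)=\{p\in\mathbb{TP}_{\min}^{d-1} : p_i=\infty\text{ iff }i\in Z\}$, identified with $\mathbb R^{[d]\setminus Z}/\mathbb R\mathbf 1$. For $u\in\mathbb T_{\min}^d$ and $i$ with $u_i\neq\infty$ the sector is $S_i(u)=\{z\in\mathbb R^d : z_\ell-z_i\le u_\ell-u_i\text{ for all }\ell\text{ with }u_\ell\neq\infty\}$. The sectors of $u$ are the maximal cells of a polyhedral complex $\Delta(u)$ covering $\mathbb R^d$ (its cells are intersections of nonempty families of sectors of $u$). The covector decomposition $\mathcal T(V)$ of $\mathbb R^d$ is the common refinement of the complexes $\Delta(v^{(j)})$, where $v^{(j)}$ is the $j$th column of $V$; it induces a decomposition of $\mathbb R^d/\mathbb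 R\mathbf 1$. For a matrix with no columns it consists of the single cell $\mathbb R^d$. $V(Z)$ is the matrix obtained from $V$ by removing all columns $j$ for which there is an $i\in Z$ with $v_{ij}\ne\infty$, and then removing the rows with labels in $Z$. It has rows labeled by $[d]\setminus Z$, and its covector decomposition of $\mathbb R^{[d]\setminus Z}/\mathbb R\mathbf 1$ is a decomposition of the stratum $\mathbb{TP}_{\min}^{d-1}(Z)$. In particular $V(\emptyset)=V$. "Piecewise linear decomposition" means: the resulting finite family of cells (each being a polyhedron in its stratum) covers $\mathbb{TP}_{\min}^{d-1}$, the closure in $\mathbb{TP}_{\min}^{d-1}$ of each cell is a union of cells of the family, and the intersection of the closures of any two cells is a (possibly empty) union of cells of the family. *)

theory Defs
  imports "HOL-Analysis.Analysis"
begin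

section \<open>Tropical projective space\<close>

text \<open>The index set \<open>[d]\<close> is the finite type \<open>'d\<close>.  The min-tropical numbers carry the topology
  induced from \<^typ>\<open>ereal\<close>.\<close>

definition tmin :: "ereal set" where
  "tmin = {x. x \<noteq> -\<infinity>}"

definition tmin_points :: "(ereal ^ 'd) set" where
  "tmin_points = {p. (\<forall>i. p $ i \<in> tmin) \<and> (\<exists>i. p $ i \<noteq> \<infinity>)}"

definition shift_rel :: "((ereal ^ 'd) \<times> (ereal ^ 'd)) set" where
  "shift_rel = {(p, q). p \<in> tmin_points \<and> q \<in> tmin_points \<and>
     (\<exists>c::real. \<forall>i. q $ i = p $ i + ereal c)}"

definition tp_class :: "ereal ^ 'd \<Rightarrow> (ereal ^ 'd) set" where
  "tp_class p = shift_rel `` {p}"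

definition tp_space :: "(ereal ^ 'd) set set" where
  "tp_space = tmin_points // shift_rel"

definition tp_topology :: "(ereal ^ 'd) set topology" where
  "tp_topology = topology (\<lambda>U. U \<subseteq> tp_space \<and>
     openin (top_of_set tmin_points) {p \<in> tmin_points. tp_class p \<in> U})"

definition tp_stratum :: "'d set \<Rightarrow> (ereal ^ 'd) set set" where
  "tp_stratum Z = {tp_class p | p. p \<in> tmin_points \<and> (\<forall>i. p $ i = \<infinity> \<longleftrightarrow> i \<in> Z)}"

lemma equiv_shift_rel: "equiv tmin_points shift_rel"
proof (rule equivI)
  show "shift_rel \<subseteq> tmin_points \<times> (tmin_points :: (ereal ^ 'd) set)"
    by (auto simp: shift_rel_def)
  show "refl_on tmin_points (shift_rel :: ((ereal ^ 'd) \<times> _) set)"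
    unfolding refl_on_def shift_rel_def by (auto intro: exI[of _ 0])
  show "sym (shift_rel :: ((ereal ^ 'd) \<times> _) set)"
  proof (rule symI)
    fix p q :: "ereal ^ 'd"
    assume "(p, q) \<in> shift_rel"
    then obtain c where c: "p \<in> tmin_points" "q \<in> tmin_points"
        "\<And>i. q $ i = p $ i + ereal c"
      by (auto simp: shift_rel_def)
    have "p $ i = q $ i + ereal (- c)" for i
      unfolding c(3) by (cases "p $ i") auto
    then show "(q, p) \<in> shift_rel"
      using c by (auto simp: shift_rel_def)
  qed
  show "trans (shift_rel :: ((ereal ^ 'd) \<times> _) set)"
  proof (rule transI)
    fix p q r :: "ereal ^ 'd"
    assume "(p, q) \<in> shift_rel" "(q, r) \<in> shift_rel"
    then obtain c e where c: "p \<in> tmin_points" "r \<in> tmin_points"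
        "\<And>i. q $ i = p $ i + ereal c" "\<And>i. r $ i = q $ i + ereal e"
      by (auto simp: shift_rel_def)
    have "r $ i = p $ i + ereal (c + e)" for i
      unfolding c(3,4) by (cases "p $ i") auto
    then show "(p, r) \<in> shift_rel"
      using c by (auto simp: shift_rel_def)
  qed
qed

lemma tp_space_image: "tp_space = tp_class ` tmin_points"
  by (auto simp: tp_space_def tp_class_def quotient_def)

lemma openin_tp_topology:
  fixes U :: "(ereal ^ 'd) set set"
  shows "openin tp_topology U \<longleftrightarrow> U \<subseteq> tp_space \<and>
     openin (top_of_set tmin_points) {p \<in> tmin_points. tp_class p \<in> U}"
proof -
  let ?L = "\<lambda>U. U \<subseteq> (tp_space :: (ereal ^ 'd) set set) \<and>
     openin (top_of_set tmin_points) {p \<in> tmin_points. tp_class p \<in> U}"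
  have "istopology ?L"
    unfolding istopology_def
  proof (intro conjI allI impI)
    fix S T :: "(ereal ^ 'd) set set"
    assume S: "?L S" and T: "?L T"
    have "{p \<in> tmin_points. tp_class p \<in> S \<inter> T} =
        {p \<in> tmin_points. tp_class p \<in> S} \<inter> {p \<in> tmin_points. tp_class p \<in> T}"
      by auto
    then show "openin (top_of_set tmin_points) {p \<in> tmin_points. tp_class p \<in> S \<inter> T}"
      using openin_Int[OF conjunct2[OF S] conjunct2[OF T]] by (simp only:)
    show "S \<inter> T \<subseteq> tp_space"
      using S by auto
  next
    fix \<K> :: "(ereal ^ 'd) set set set"
    assume K: "\<forall>K\<in>\<K>. ?L K"
    have "{p \<in> tmin_points. tp_class p \<in> \<Union>\<K>} =
        (\<Union>K\<in>\<K>. {p \<in> tmin_points. tp_class p \<in> K})"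
      by auto
    moreover have "openin (top_of_set tmin_points) (\<Union>K\<in>\<K>. {p \<in> tmin_points. tp_class p \<in> K})"
      by (rule openin_Union) (use K in blast)
    ultimately show "openin (top_of_set tmin_points) {p \<in> tmin_points. tp_class p \<in> \<Union>\<K>}"
      by (simp only:)
    show "\<Union>\<K> \<subseteq> tp_space"
      using K by auto
  qed
  then show ?thesis
    unfolding tp_topology_def by (simp only: topology_inverse')
qed

lemma topspace_tp_topology: "topspace tp_topology = (tp_space :: (ereal ^ 'd) set set)"
proof -
  have "openin tp_topology (tp_space :: (ereal ^ 'd) set set)"
    unfolding openin_tp_topology
  proof
    have "{p \<in> tmin_points. tp_class p \<in> (tp_space :: (ereal ^ 'd) set set)} = tmin_points"
      by (auto simp: tp_space_image)
    then show "openin (top_of_set tmin_points)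
        {p \<in> tmin_points. tp_class p \<in> (tp_space :: (ereal ^ 'd) set set)}"
      by simp
  qed simp
  then show ?thesis
    using openin_subset[of tp_topology tp_space] openin_topspace[of tp_topology]
    unfolding openin_tp_topology[of "topspace tp_topology"] by blast
qed

lemma quotient_map_tp_class: "quotient_map (top_of_set tmin_points) tp_topology tp_class"
  by (simp add: quotient_map_def topspace_tp_topology tp_space_image openin_tp_topology)


section \<open>Covector decompositions\<close>

text \<open>A matrix with row labels \<open>R\<close> and column labels \<open>C\<close> is given by its entries \<open>V i j\<close> for
  \<open>i \<in> R\<close> and \<open>j \<in> C\<close>.  The space of real vectors indexed by \<open>R\<close> is realised as the coordinate
  subspace of \<^typ>\<open>real ^ 'd\<close> of vectors vanishing outside \<open>R\<close>.\<close>

definition coord_space :: "'d set \<Rightarrow> (real ^ 'd) set" where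
  "coord_space R = {z. \<forall>i. i \<notin> R \<longrightarrow> z $ i = 0}"

definition sector :: "'d set \<Rightarrow> ('d \<Rightarrow> ereal) \<Rightarrow> 'd \<Rightarrow> (real ^ 'd) set" where
  "sector R u i =
     {z \<in> coord_space R. \<forall>l\<in>R. u l \<noteq> \<infinity> \<longrightarrow> ereal (z $ l - z $ i) \<le> u l - u i}"

definition sectors :: "'d set \<Rightarrow> ('d \<Rightarrow> ereal) \<Rightarrow> (real ^ 'd) set set" where
  "sectors R u = {sector R u i | i. i \<in> R \<and> u i \<noteq> \<infinity>}"

definition sector_complex :: "'d set \<Rightarrow> ('d \<Rightarrow> ereal) \<Rightarrow> (real ^ 'd) set set" where
  "sector_complex R u = {\<Inter>\<F> | \<F>. \<F> \<noteq> {} \<and> \<F> \<subseteq> sectors R u}"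

text \<open>The empty set is not counted as a cell.  Intersecting with the whole space makes the empty
  family of complexes (a matrix without columns) yield the single cell \<open>coord_space R\<close>.\<close>

definition covector_decomposition ::
    "'d set \<Rightarrow> 'n set \<Rightarrow> ('d \<Rightarrow> 'n \<Rightarrow> ereal) \<Rightarrow> (real ^ 'd) set set" where
  "covector_decomposition R C V =
     {X. X \<noteq> {} \<and> (\<exists>F. (\<forall>j\<in>C. F j \<in> sector_complex R (\<lambda>i. V i j)) \<and>
                       X = coord_space R \<inter> (\<Inter>j\<in>C. F j))}"

text \<open>The column labels of \<open>V(Z)\<close>; its row labels are \<open>- Z\<close>.\<close>

definition columns_at :: "'n set \<Rightarrow> ('d \<Rightarrow> 'n \<Rightarrow> ereal) \<Rightarrow> 'd set \<Rightarrow> 'n set" where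
  "columns_at C V Z = {j \<in> C. \<not> (\<exists>i\<in>Z. V i j \<noteq> \<infinity>)}"


section \<open>Decompositions of tropical projective space\<close>

text \<open>\<open>stratum_point Z\<close> restricted to \<open>coord_space (- Z)\<close> is the parametrisation of the stratum of
  \<open>Z\<close>; it identifies exactly the vectors that differ by a multiple of the all-ones vector
  of \<open>coord_space (- Z)\<close>.\<close>

definition stratum_point :: "'d set \<Rightarrow> real ^ 'd \<Rightarrow> (ereal ^ 'd) set" where
  "stratum_point Z z = tp_class (\<chi> i. if i \<in> Z then \<infinity> else ereal (z $ i))"

lemma stratum_point_image:
  assumes "Z \<noteq> (UNIV :: 'd::finite set)"
  shows "stratum_point Z ` coord_space (- Z) = (tp_stratum Z :: (ereal ^ 'd) set set)"
proof (intro equalityI subsetI)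
  fix X :: "(ereal ^ 'd) set"
  assume "X \<in> stratum_point Z ` coord_space (- Z)"
  then obtain z where z: "X = stratum_point Z z"
    by auto
  show "X \<in> tp_stratum Z"
    unfolding tp_stratum_def z stratum_point_def
    using assms
    by (intro CollectI exI[of _ "\<chi> i. if i \<in> Z then \<infinity> else ereal (z $ i)"])
       (auto simp: tmin_points_def tmin_def)
next
  fix X :: "(ereal ^ 'd) set"
  assume "X \<in> tp_stratum Z"
  then obtain p where p: "X = tp_class p" "p \<in> tmin_points" "\<And>i. p $ i = \<infinity> \<longleftrightarrow> i \<in> Z"
    by (auto simp: tp_stratum_def)
  define z :: "real ^ 'd" where "z = (\<chi> i. if i \<in> Z then 0 else real_of_ereal (p $ i))"
  have "p = (\<chi> i. if i \<in> Z then \<infinity> else ereal (z $ i))"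
    using p(2,3) by (auto simp: vec_eq_iff z_def tmin_points_def tmin_def ereal_real)
  then have "X = stratum_point Z z"
    by (simp add: p(1) stratum_point_def)
  moreover have "z \<in> coord_space (- Z)"
    by (simp add: z_def coord_space_def)
  ultimately show "X \<in> stratum_point Z ` coord_space (- Z)"
    by blast
qed

lemma stratum_point_eq_iff:
  fixes Z :: "'d::finite set"
  assumes "Z \<noteq> UNIV"
  shows "stratum_point Z x = stratum_point Z y \<longleftrightarrow> (\<exists>c. \<forall>i. i \<notin> Z \<longrightarrow> y $ i = x $ i + c)"
proof -
  have mem: "(\<chi> i. if i \<in> Z then \<infinity> else ereal (z $ i)) \<in> (tmin_points :: (ereal ^ 'd) set)"
    for z :: "real ^ 'd"
    using assms by (auto simp: tmin_points_def tmin_def)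
  have "stratum_point Z x = stratum_point Z y \<longleftrightarrow>
      ((\<chi> i. if i \<in> Z then \<infinity> else ereal (x $ i)),
       (\<chi> i. if i \<in> Z then \<infinity> else ereal (y $ i))) \<in> shift_rel"
    unfolding stratum_point_def tp_class_def
    by (rule eq_equiv_class_iff[OF equiv_shift_rel mem mem])
  also have "\<dots> \<longleftrightarrow> (\<exists>c. \<forall>i. i \<notin> Z \<longrightarrow> y $ i = x $ i + c)"
    unfolding shift_rel_def using mem by (auto split: if_splits)
  finally show ?thesis .
qed

definition tp_covector_cells ::
    "'n set \<Rightarrow> ('d \<Rightarrow> 'n \<Rightarrow> ereal) \<Rightarrow> (ereal ^ 'd) set set set" where
  "tp_covector_cells C V =
     (\<Union>Z\<in>{Z. Z \<subset> UNIV}. (\<lambda>X. stratum_point Z ` X) `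
        covector_decomposition (- Z) (columns_at C V Z) V)"

definition stratum_polyhedron :: "'d set \<Rightarrow> (ereal ^ 'd) set set \<Rightarrow> bool" where
  "stratum_polyhedron Z A \<longleftrightarrow>
     (\<exists>P. polyhedron P \<and> P \<subseteq> coord_space (- Z) \<and> A = stratum_point Z ` P)"

definition piecewise_linear_decomposition :: "(ereal ^ 'd) set set set \<Rightarrow> bool" where
  "piecewise_linear_decomposition \<C> \<longleftrightarrow>
     finite \<C> \<and>
     (\<forall>A\<in>\<C>. \<exists>Z. Z \<subset> UNIV \<and> stratum_polyhedron Z A) \<and>
     \<Union>\<C> = tp_space \<and>
     (\<forall>A\<in>\<C>. \<exists>\<D>\<subseteq>\<C>. tp_topology closure_of A = \<Union>\<D>) \<and>
     (\<forall>A\<in>\<C>. \<forall>B\<in>\<C>. \<exists>\<D>\<subseteq>\<C>.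
        tp_topology closure_of A \<inter> tp_topology closure_of B = \<Union>\<D>)"

end

theory Submission
  imports Defs
begin

text \<open>Extend the inequalities defining a covector cell to points with infinite coordinates: the
  covector of \<open>p\<close> at column \<open>j\<close> is the set of rows at which \<open>p\<^sub>l - v\<^sub>l\<^sub>j\<close> is maximal. If column \<open>j\<close>
  is removed in \<open>V(Z)\<close>, this maximum is \<open>\<infinity>\<close> on the stratum of \<open>Z\<close>. The points that
  are infinite on \<open>Z\<close> and whose covectors contain prescribed sets form a closed set. It is a union
  of cells, since the cell of a point \<open>p\<close> given by the covectors of \<open>p\<close> at the remaining columns
  stays inside it. Such sets are stable under intersection, and the closure of a cell is one of them:
  to approach \<open>p\<close> from the cell of \<open>y\<close>, replace the infinite coordinates of \<open>p\<close> by those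
  of \<open>y + t\<close> and let \<open>t\<close> tend to infinity.\<close>

section \<open>Shifts, limits and continuity in extended real coordinates\<close>

lemma tp_class_eq_iff:
  assumes "p \<in> tmin_points" "q \<in> tmin_points"
  shows "tp_class p = tp_class q \<longleftrightarrow> (\<exists>c::real. \<forall>i. q $ i = p $ i + ereal c)"
  using eq_equiv_class_iff[OF equiv_shift_rel assms] assms
  by (simp add: tp_class_def shift_rel_def)

lemma tmin_points_not_MInfty: "p \<in> tmin_points \<Longrightarrow> p $ i \<noteq> - \<infinity>"
  by (auto simp: tmin_points_def tmin_def)

lemma finite_coordinates_tp_class:
  assumes "p \<in> tmin_points" "{i. p $ i = \<infinity>} = Z"
  shows "p = (\<chi> i. if i \<in> Z then \<infinity> else ereal (real_of_ereal (p $ i)))"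
  using assms by (auto simp: vec_eq_iff tmin_points_def tmin_def ereal_real)

lemma tendsto_add_ereal_PInfty:
  assumes "y \<noteq> - \<infinity>"
  shows "(\<lambda>t. y + ereal (real t)) \<longlonglongrightarrow> \<infinity>"
proof (cases y)
  case (real r)
  have "filterlim (\<lambda>t. r + real t) at_top sequentially"
    by (rule filterlim_tendsto_add_at_top[OF tendsto_const filterlim_real_sequentially])
  then have "(\<lambda>t. ereal (r + real t)) \<longlonglongrightarrow> \<infinity>"
    by (simp add: tendsto_PInfty_eq_at_top)
  then show ?thesis
    using real by simp
qed (use assms in auto)

text \<open>Addition on \<open>ereal\<close> is discontinuous only where infinities of opposite sign
  meet, which a real summand excludes.\<close>

lemma continuous_on_ereal_add_real:
  fixes f :: "'a::topological_space \<Rightarrow> ereal"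
  assumes "continuous_on S f"
  shows "continuous_on S (\<lambda>x. f x + ereal c)"
  using assms unfolding continuous_on_def
  by (auto intro!: tendsto_add_ereal_general2)

lemma Union_of_subfamily:
  assumes "\<And>x. x \<in> S \<Longrightarrow> \<exists>A\<in>\<C>. x \<in> A \<and> A \<subseteq> S"
  shows "\<exists>\<D>\<subseteq>\<C>. S = \<Union>\<D>"
  by (rule exI[of _ "{A \<in> \<C>. A \<subseteq> S}"]) (use assms in blast)

section \<open>Covectors and cells with infinite coordinates\<close>

locale tropical_matrix =
  fixes V :: "'d::finite \<Rightarrow> 'n \<Rightarrow> ereal" and C :: "'n set"
  assumes finite_columns: "finite C"
    and entries: "j \<in> C \<Longrightarrow> V i j \<noteq> - \<infinity>"
    and columns: "j \<in> C \<Longrightarrow> \<exists>i. V i j \<noteq> \<infinity>"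
begin

text \<open>The comparison of p_l - v_lj with p_i - v_ij, rearranged so that only a real constant is
  added to p_i. Each inequality then defines a closed set and holds trivially where p_i is
  infinite.\<close>

definition covector :: "ereal ^ 'd \<Rightarrow> 'n \<Rightarrow> 'd set" where
  "covector p j = {i. V i j \<noteq> \<infinity> \<and> (\<forall>l. V l j \<noteq> \<infinity> \<longrightarrow>
     p $ l \<le> p $ i + ereal (real_of_ereal (V l j) - real_of_ereal (V i j)))}"

text \<open>Infinite coordinates are prescribed on \<open>Z\<close> but allowed elsewhere, so that
  boundary strata are included. \<open>Z\<close> may be the set of all rows, giving the empty set;
  this keeps the family stable under intersection.\<close>

definition closed_cell :: "'d set \<Rightarrow> ('n \<Rightarrow> 'd set) \<Rightarrow> (ereal ^ 'd) set" where
  "closed_cell Z I =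
     {p \<in> tmin_points. (\<forall>i\<in>Z. p $ i = \<infinity>) \<and> (\<forall>j\<in>C. I j \<subseteq> covector p j)}"

definition rel_cell :: "'d set \<Rightarrow> ('n \<Rightarrow> 'd set) \<Rightarrow> (ereal ^ 'd) set" where
  "rel_cell Z I = {p \<in> closed_cell Z I. {i. p $ i = \<infinity>} = Z}"

definition real_cell :: "'d set \<Rightarrow> ('n \<Rightarrow> 'd set) \<Rightarrow> (real ^ 'd) set" where
  "real_cell Z I = {z \<in> coord_space (- Z). \<forall>j\<in>columns_at C V Z.
     \<forall>i\<in>I j. \<forall>l. V l j \<noteq> \<infinity> \<longrightarrow> z $ l - z $ i \<le> real_of_ereal (V l j) - real_of_ereal (V i j)}"

lemma columns_atD: "j \<in> columns_at C V Z \<Longrightarrow> V i j \<noteq> \<infinity> \<Longrightarrow> i \<notin> Z"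
  by (auto simp: columns_at_def)

lemma columns_at_subset: "columns_at C V Z \<subseteq> C"
  by (auto simp: columns_at_def)

text \<open>A column surviving in V(Z) has all its finite entries outside \<open>Z\<close>, so
  \<open>l\<close> ranges over rows of V(Z) automatically, and the entries compared are
  real.\<close>

lemma sector_eq:
  assumes "j \<in> columns_at C V Z" "V i j \<noteq> \<infinity>"
  shows "sector (- Z) (\<lambda>i. V i j) i = {z \<in> coord_space (- Z). \<forall>l. V l j \<noteq> \<infinity> \<longrightarrow>
    z $ l - z $ i \<le> real_of_ereal (V l j) - real_of_ereal (V i j)}"
proof -
  have "ereal (z $ l - z $ i) \<le> V l j - V i j \<longleftrightarrow>
      z $ l - z $ i \<le> real_of_ereal (V l j) - real_of_ereal (V i j)"
    if "V l j \<noteq> \<infinity>" for z :: "real ^ 'd" and l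
    using that assms entries[of j l] entries[of j i] columns_at_subset[of Z]
    by (cases "V l j"; cases "V i j") auto
  then show ?thesis
    using columns_atD[OF assms(1)] by (auto simp: sector_def)
qed

text \<open>A cell selects for each surviving column a nonempty set \<open>I j\<close> of rows,
  naming the sectors to intersect. \<open>I\<close> is normalised to be empty at all other columns,
  so that conditions imposed over all of \<open>C\<close> say nothing there.\<close>

lemma covector_decomposition_eq:
  "covector_decomposition (- Z) (columns_at C V Z) V =
    {real_cell Z I | I. real_cell Z I \<noteq> {} \<and> (\<forall>j. I j \<subseteq> {i. V i j \<noteq> \<infinity>}) \<and>
       (\<forall>j. I j \<noteq> {} \<longleftrightarrow> j \<in> columns_at C V Z)}" (is "?L = ?R")
proof (intro equalityI subsetI)
  fix X assume "X \<in> ?L"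
  then obtain F where F: "X \<noteq> {}" "X = coord_space (- Z) \<inter> (\<Inter>j\<in>columns_at C V Z. F j)"
    "\<And>j. j \<in> columns_at C V Z \<Longrightarrow> F j \<in> sector_complex (- Z) (\<lambda>i. V i j)"
    by (auto simp: covector_decomposition_def)
  have "\<exists>J. J \<noteq> {} \<and> J \<subseteq> {i. V i j \<noteq> \<infinity>} \<and> F j = (\<Inter>i\<in>J. sector (- Z) (\<lambda>i. V i j) i)"
    if j: "j \<in> columns_at C V Z" for j
  proof -
    obtain G where G: "F j = \<Inter>G" "G \<noteq> {}" "G \<subseteq> sectors (- Z) (\<lambda>i. V i j)"
      using F(3)[OF j] by (auto simp: sector_complex_def)
    \<comment> \<open>Sectors are indexed by rows, so every family of sectors is the image of a set
      of rows.\<close>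
    have "sectors (- Z) (\<lambda>i. V i j) = sector (- Z) (\<lambda>i. V i j) ` {i \<in> - Z. V i j \<noteq> \<infinity>}"
      by (auto simp: sectors_def)
    then obtain J where "J \<subseteq> {i \<in> - Z. V i j \<noteq> \<infinity>}" "G = sector (- Z) (\<lambda>i. V i j) ` J"
      using G(3) by (auto simp only: subset_image_iff)
    with G show ?thesis
      by (intro exI[of _ J]) auto
  qed
  then obtain J where J: "\<And>j. j \<in> columns_at C V Z \<Longrightarrow>
      J j \<noteq> {} \<and> J j \<subseteq> {i. V i j \<noteq> \<infinity>} \<and> F j = (\<Inter>i\<in>J j. sector (- Z) (\<lambda>i. V i j) i)"
    by metis
  define I where "I = (\<lambda>j. if j \<in> columns_at C V Z then J j else {})"
  have "sector (- Z) (\<lambda>i. V i j) i = {z \<in> coord_space (- Z). \<forall>l. V l j \<noteq> \<infinity> \<longrightarrow>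
    z $ l - z $ i \<le> real_of_ereal (V l j) - real_of_ereal (V i j)}"
    if "j \<in> columns_at C V Z" "i \<in> J j" for i j
    using sector_eq that J by blast
  then have "X = real_cell Z I"
    unfolding F(2) real_cell_def using J by (auto simp: I_def)
  moreover have "I j \<subseteq> {i. V i j \<noteq> \<infinity>}" "I j \<noteq> {} \<longleftrightarrow> j \<in> columns_at C V Z" for j
    using J[of j] by (auto simp: I_def)
  ultimately show "X \<in> ?R"
    using F(1) by blast
next
  fix X assume "X \<in> ?R"
  then obtain I where I: "X = real_cell Z I" "X \<noteq> {}" "\<And>j. I j \<subseteq> {i. V i j \<noteq> \<infinity>}"
    "\<And>j. I j \<noteq> {} \<longleftrightarrow> j \<in> columns_at C V Z"
    by auto
  define F where "F = (\<lambda>j. \<Inter>(sector (- Z) (\<lambda>i. V i j) ` I j))"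
  have "F j \<in> sector_complex (- Z) (\<lambda>i. V i j)" if "j \<in> columns_at C V Z" for j
    unfolding F_def sector_complex_def sectors_def
    using I(3)[of j] I(4)[of j] that columns_atD[OF that]
    by (intro CollectI exI[of _ "sector (- Z) (\<lambda>i. V i j) ` I j"]) blast
  moreover have "sector (- Z) (\<lambda>i. V i j) i = {z \<in> coord_space (- Z). \<forall>l. V l j \<noteq> \<infinity> \<longrightarrow>
    z $ l - z $ i \<le> real_of_ereal (V l j) - real_of_ereal (V i j)}"
    if "j \<in> columns_at C V Z" "i \<in> I j" for i j
    using sector_eq that I(3) by blast
  then have "X = coord_space (- Z) \<inter> (\<Inter>j\<in>columns_at C V Z. F j)"
    unfolding I(1) real_cell_def F_def by auto
  ultimately show "X \<in> ?L"
    unfolding covector_decomposition_def using I(2) by blast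
qed

section \<open>Polyhedrality, passage to the strata, and finiteness\<close>

lemma polyhedron_real_cell: "polyhedron (real_cell Z I)"
proof -
  \<comment> \<open>The halfspaces cutting out a sector have normal vectors e_l - e_i.\<close>
  have comp: "(axis l 1 - axis i 1) \<bullet> z = z $ l - z $ i" for l i and z :: "real ^ 'd"
    by (simp add: inner_diff_left inner_axis')
  have "polyhedron {z :: real ^ 'd. z $ i = 0}" for i
    using polyhedron_hyperplane[of "axis i 1 :: real ^ 'd" 0] by (simp add: inner_axis')
  moreover have "polyhedron {z :: real ^ 'd. z $ l - z $ i \<le> c}" for l i c
    using polyhedron_halfspace_le[of "axis l 1 - axis i 1 :: real ^ 'd" c] by (simp only: comp)
  moreover have "real_cell Z I = (\<Inter>i\<in>Z. {z. z $ i = 0}) \<inter> (\<Inter>j\<in>columns_at C V Z. \<Inter>i\<in>I j.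
      \<Inter>l\<in>{l. V l j \<noteq> \<infinity>}. {z. z $ l - z $ i \<le> real_of_ereal (V l j) - real_of_ereal (V i j)})"
    by (auto simp: real_cell_def coord_space_def)
  ultimately show ?thesis
    using finite_subset[OF columns_at_subset finite_columns]
    by (auto intro!: polyhedron_Int polyhedron_Inter)
qed

text \<open>Adjoining infinite coordinates on \<open>Z\<close> maps \<open>coord_space (- Z)\<close>
  onto the points infinite exactly on \<open>Z\<close>. At a surviving column all coordinates
  compared are finite, so the extended inequalities are the real ones.\<close>

lemma stratum_point_real_cell:
  assumes Z: "Z \<noteq> UNIV" and supp: "\<And>j. I j \<subseteq> {i. V i j \<noteq> \<infinity>}"
    and cols: "\<And>j. I j \<noteq> {} \<longleftrightarrow> j \<in> columns_at C V Z"
  shows "stratum_point Z ` real_cell Z I = tp_class ` rel_cell Z I"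
proof -
  define e where "e = (\<lambda>z :: real ^ 'd. \<chi> i. if i \<in> Z then \<infinity> else ereal (z $ i))"
  have mem: "e z \<in> rel_cell Z I \<longleftrightarrow> z \<in> real_cell Z I" if z: "z \<in> coord_space (- Z)" for z
  proof -
    have "e z \<in> tmin_points" "{i. e z $ i = \<infinity>} = Z"
      using Z by (auto simp: e_def tmin_points_def tmin_def)
    then have "e z \<in> rel_cell Z I \<longleftrightarrow> (\<forall>j\<in>C. I j \<subseteq> covector (e z) j)"
      by (auto simp: rel_cell_def closed_cell_def)
    \<comment> \<open>At the removed columns \<open>I j\<close> is empty.\<close>
    also have "\<dots> \<longleftrightarrow> (\<forall>j\<in>columns_at C V Z. I j \<subseteq> covector (e z) j)"
      using cols columns_at_subset[of Z] by blast
    also have "\<dots> \<longleftrightarrow> (\<forall>j\<in>columns_at C V Z. \<forall>i\<in>I j. \<forall>l. V l j \<noteq> \<infinity> \<longrightarrow>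
        z $ l - z $ i \<le> real_of_ereal (V l j) - real_of_ereal (V i j))"
    proof (rule ball_cong[OF refl])
      fix j assume j: "j \<in> columns_at C V Z"
      have "e z $ l \<le> e z $ i + ereal c \<longleftrightarrow> z $ l - z $ i \<le> c"
        if "V l j \<noteq> \<infinity>" "V i j \<noteq> \<infinity>" for l i c
        using columns_atD[OF j] that by (auto simp: e_def)
      then show "I j \<subseteq> covector (e z) j \<longleftrightarrow> (\<forall>i\<in>I j. \<forall>l. V l j \<noteq> \<infinity> \<longrightarrow>
          z $ l - z $ i \<le> real_of_ereal (V l j) - real_of_ereal (V i j))"
        using supp[of j] by (auto simp: covector_def subset_iff)
    qed
    finally show ?thesis
      using z by (simp add: real_cell_def)
  qed
  have "rel_cell Z I \<subseteq> e ` coord_space (- Z)"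
  proof
    fix p assume "p \<in> rel_cell Z I"
    then have p: "p \<in> tmin_points" "{i. p $ i = \<infinity>} = Z"
      by (auto simp: rel_cell_def closed_cell_def)
    have "p = e (\<chi> i. if i \<in> Z then 0 else real_of_ereal (p $ i))"
      by (subst finite_coordinates_tp_class[OF p]) (simp add: e_def vec_eq_iff)
    then show "p \<in> e ` coord_space (- Z)"
      by (rule image_eqI) (simp add: coord_space_def)
  qed
  moreover have "real_cell Z I \<subseteq> coord_space (- Z)"
    by (auto simp: real_cell_def)
  ultimately have "rel_cell Z I = e ` real_cell Z I"
    using mem by blast
  then show ?thesis
    by (simp add: image_image stratum_point_def e_def)
qed

lemma tp_covector_cells_iff:
  "A \<in> tp_covector_cells C V \<longleftrightarrow> (\<exists>Z I. (\<forall>j. I j \<noteq> {} \<longleftrightarrow> j \<in> columns_at C V Z) \<and>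
     rel_cell Z I \<noteq> {} \<and> A = tp_class ` rel_cell Z I)" (is "?L \<longleftrightarrow> ?R")
proof
  assume ?L
  then obtain Z I where I: "Z \<noteq> UNIV" "real_cell Z I \<noteq> {}" "\<And>j. I j \<subseteq> {i. V i j \<noteq> \<infinity>}"
    "\<And>j. I j \<noteq> {} \<longleftrightarrow> j \<in> columns_at C V Z" "A = stratum_point Z ` real_cell Z I"
    unfolding tp_covector_cells_def covector_decomposition_eq by blast
  then show ?R
    using stratum_point_real_cell[OF I(1,3,4)]
    by (intro exI[of _ Z] exI[of _ I]) (metis image_is_empty)
next
  assume ?R
  then obtain Z I where I: "\<And>j. I j \<noteq> {} \<longleftrightarrow> j \<in> columns_at C V Z"
    "rel_cell Z I \<noteq> {}" "A = tp_class ` rel_cell Z I"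
    by blast
  then obtain p where p: "p \<in> rel_cell Z I"
    by blast
  \<comment> \<open>A point of the cell has a finite coordinate, so \<open>Z\<close> is proper, and
    its covectors confine \<open>I j\<close> to the support of column j.\<close>
  then have Z: "Z \<noteq> UNIV" and "\<forall>j\<in>C. I j \<subseteq> covector p j"
    by (auto simp: rel_cell_def closed_cell_def tmin_points_def)
  then have supp: "I j \<subseteq> {i. V i j \<noteq> \<infinity>}" for j
    using I(1)[of j] columns_at_subset[of Z] by (cases "j \<in> C") (auto simp: covector_def)
  note eq = stratum_point_real_cell[OF Z supp I(1)]
  then have "real_cell Z I \<noteq> {}"
    using I(2) by (metis image_is_empty)
  then have "real_cell Z I \<in> covector_decomposition (- Z) (columns_at C V Z) V"
    unfolding covector_decomposition_eq using supp I(1) by blast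
  then show ?L
    unfolding tp_covector_cells_def I(3) eq[symmetric] using Z
    by (intro UN_I[of Z] imageI) auto
qed

text \<open>\<open>rel_cell\<close> sees \<open>I\<close> only on \<open>C\<close>, so finitely many
  pairs of a stratum and a restricted \<open>I\<close> produce all cells.\<close>

lemma finite_tp_covector_cells: "finite (tp_covector_cells C V)"
proof (rule finite_subset)
  show "finite ((\<lambda>(Z, I). tp_class ` rel_cell Z I) ` (UNIV \<times> (C \<rightarrow>\<^sub>E UNIV)))"
    using finite_columns by (intro finite_imageI finite_cartesian_product finite_PiE) auto
  show "tp_covector_cells C V \<subseteq> (\<lambda>(Z, I). tp_class ` rel_cell Z I) ` (UNIV \<times> (C \<rightarrow>\<^sub>E UNIV))"
  proof
    fix A assume "A \<in> tp_covector_cells C V"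
    then obtain Z I where "A = tp_class ` rel_cell Z I"
      by (auto simp: tp_covector_cells_iff)
    also have "rel_cell Z I = rel_cell Z (restrict I C)"
      by (simp add: rel_cell_def closed_cell_def)
    finally show "A \<in> (\<lambda>(Z, I). tp_class ` rel_cell Z I) ` (UNIV \<times> (C \<rightarrow>\<^sub>E UNIV))"
      by (auto intro!: image_eqI[of _ _ "(Z, restrict I C)"])
  qed
qed

lemma stratum_polyhedron_tp_covector_cells:
  assumes "A \<in> tp_covector_cells C V"
  shows "\<exists>Z. Z \<subset> UNIV \<and> stratum_polyhedron Z A"
proof -
  obtain Z I where "Z \<subset> UNIV" "A = stratum_point Z ` real_cell Z I"
    using assms unfolding tp_covector_cells_def covector_decomposition_eq by blast
  then show ?thesis
    using polyhedron_real_cell[of Z I] unfolding stratum_polyhedron_def real_cell_def by blast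
qed

section \<open>Closed cells as unions of cells\<close>

lemma covector_nonempty:
  assumes "p \<in> tmin_points" "j \<in> columns_at C V {i. p $ i = \<infinity>}"
  shows "covector p j \<noteq> {}"
proof -
  \<comment> \<open>On the support of a surviving column \<open>p\<close> is finite, so
    \<open>?f\<close> is the true difference p_i - v_ij there. A row maximising it over this finite
    nonempty support lies in the covector.\<close>
  let ?S = "{i. V i j \<noteq> \<infinity>}" and ?f = "\<lambda>i. real_of_ereal (p $ i) - real_of_ereal (V i j)"
  have "?S \<noteq> {}"
    using columns assms(2) columns_at_subset by blast
  then obtain i where i: "i \<in> ?S" "\<And>l. l \<in> ?S \<Longrightarrow> ?f l \<le> ?f i"
    using Max_in[of "?f ` ?S"] Max_ge[of "?f ` ?S"] by fastforce
  have fin: "p $ l = ereal (real_of_ereal (p $ l))" if "l \<in> ?S" for l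
    using columns_atD[OF assms(2)] that tmin_points_not_MInfty[OF assms(1)]
    by (auto simp: ereal_real)
  have "p $ l \<le> p $ i + ereal (real_of_ereal (V l j) - real_of_ereal (V i j))"
    if "l \<in> ?S" for l
    by (subst fin[OF that], subst fin[OF i(1)]) (use i(2)[OF that] in simp)
  then show ?thesis
    using i(1) by (auto simp: covector_def)
qed

lemma closed_cell_Union:
  "\<exists>\<D>\<subseteq>tp_covector_cells C V. tp_class ` closed_cell Z I = \<Union>\<D>"
proof (rule Union_of_subfamily)
  fix x assume "x \<in> tp_class ` closed_cell Z I"
  then obtain p where p: "p \<in> closed_cell Z I" "x = tp_class p"
    by blast
  then have tmin: "p \<in> tmin_points" and inf: "\<And>i. i \<in> Z \<Longrightarrow> p $ i = \<infinity>"
    and cov: "\<And>j. j \<in> C \<Longrightarrow> I j \<subseteq> covector p j"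
    by (auto simp: closed_cell_def)
  \<comment> \<open>The stratum \<open>W\<close> of \<open>p\<close> with the full covectors of
    \<open>p\<close> at its surviving columns determines the smallest cell through
    \<open>p\<close>.\<close>
  define W where "W = {i. p $ i = \<infinity>}"
  define J where "J = (\<lambda>j. if j \<in> columns_at C V W then covector p j else {})"
  have pJ: "p \<in> rel_cell W J"
    using tmin by (auto simp: rel_cell_def closed_cell_def W_def J_def)
  have "J j \<noteq> {} \<longleftrightarrow> j \<in> columns_at C V W" for j
    using covector_nonempty[OF tmin, of j] by (simp add: J_def W_def)
  then have "tp_class ` rel_cell W J \<in> tp_covector_cells C V"
    using pJ by (auto simp: tp_covector_cells_iff)
  moreover have "rel_cell W J \<subseteq> closed_cell Z I"
  proof
    fix q assume q: "q \<in> rel_cell W J"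
    have "I j \<subseteq> covector q j" if j: "j \<in> C" for j
    proof (cases "j \<in> columns_at C V W")
      case True
      have "J j \<subseteq> covector q j"
        using q j by (simp add: rel_cell_def closed_cell_def)
      then show ?thesis
        using cov[OF j] True by (simp add: J_def)
    next
      \<comment> \<open>The removed column has a support row k with p_k infinite. The inequality at
        k forces p_i to be infinite for every i in \<open>I j\<close>. All of
        \<open>rel_cell W J\<close> is infinite on \<open>W\<close>, so i stays in the
        covector.\<close>
      case False
      then obtain k where k: "p $ k = \<infinity>" "V k j \<noteq> \<infinity>"
        using j by (auto simp: columns_at_def W_def)
      show ?thesis
      proof
        fix i assume "i \<in> I j"
        then have i: "V i j \<noteq> \<infinity>" "p $ k \<le> p $ i + ereal (real_of_ereal (V k j) - real_of_ereal (V i j))"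
          using cov[OF j] k(2) by (auto simp: covector_def)
        then have "i \<in> W"
          using k(1) by (simp add: W_def)
        then have "q $ i = \<infinity>"
          using q by (auto simp: rel_cell_def)
        then show "i \<in> covector q j"
          using i(1) by (simp add: covector_def)
      qed
    qed
    then show "q \<in> closed_cell Z I"
      using q inf by (auto simp: rel_cell_def closed_cell_def W_def)
  qed
  ultimately show "\<exists>A\<in>tp_covector_cells C V. x \<in> A \<and> A \<subseteq> tp_class ` closed_cell Z I"
    using pJ unfolding p(2) by (intro bexI[of _ "tp_class ` rel_cell W J"] conjI imageI image_mono)
qed

section \<open>Closedness in the quotient topology\<close>

lemma closed_cell_saturated:
  assumes p: "p \<in> closed_cell Z I" and q: "q \<in> tmin_points" and eq: "tp_class p = tp_class q"
  shows "q \<in> closed_cell Z I"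
proof -
  have "p \<in> tmin_points"
    using p by (simp add: closed_cell_def)
  then obtain c :: real where c: "\<And>i. q $ i = p $ i + ereal c"
    using eq q tp_class_eq_iff by blast
  \<comment> \<open>A common real shift cancels from both sides, also when one of them is
    infinite.\<close>
  have shift: "q $ l \<le> q $ i + ereal b" if "p $ l \<le> p $ i + ereal b" for l i b
    using that unfolding c by (cases "p $ l"; cases "p $ i") auto
  have "covector p j \<subseteq> covector q j" for j
    using shift by (auto simp: covector_def)
  then show ?thesis
    using p q by (force simp: closed_cell_def c)
qed

text \<open>Closedness in a quotient is tested on preimages, and by saturation the preimage of the
  image is \<open>closed_cell Z I\<close> itself. That set is cut out of \<open>tmin_points\<close>
  by closed conditions.\<close>

lemma closedin_closed_cell: "closedin tp_topology (tp_class ` closed_cell Z I)"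
proof -
  have "closed {p :: ereal ^ 'd. p $ l \<le> p $ i + ereal c}" for l i c
    by (intro closed_Collect_le continuous_on_ereal_add_real continuous_on_component
        continuous_on_id)
  moreover have "closed {p :: ereal ^ 'd. p $ i = \<infinity>}" for i
    by (intro closed_Collect_eq continuous_on_component continuous_on_id continuous_on_const)
  ultimately have "closed {p. (\<forall>i\<in>Z. p $ i = \<infinity>) \<and> (\<forall>j\<in>C. I j \<subseteq> covector p j)}"
    unfolding covector_def subset_iff mem_Collect_eq Ball_def
    by (intro closed_Collect_conj closed_Collect_all closed_Collect_imp open_Collect_const)
      simp_all
  moreover have "closed_cell Z I =
      tmin_points \<inter> {p. (\<forall>i\<in>Z. p $ i = \<infinity>) \<and> (\<forall>j\<in>C. I j \<subseteq> covector p j)}"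
    by (auto simp: closed_cell_def)
  ultimately have closed: "closedin (top_of_set tmin_points) (closed_cell Z I)"
    by (simp add: closedin_closed_Int)
  have sat: "{p \<in> tmin_points. tp_class p \<in> tp_class ` closed_cell Z I} = closed_cell Z I"
  proof (intro equalityI subsetI)
    fix q assume "q \<in> {p \<in> tmin_points. tp_class p \<in> tp_class ` closed_cell Z I}"
    then obtain p where "p \<in> closed_cell Z I" "q \<in> tmin_points" "tp_class p = tp_class q"
      by auto
    then show "q \<in> closed_cell Z I"
      by (rule closed_cell_saturated)
  qed (simp add: closed_cell_def)
  have sub: "tp_class ` closed_cell Z I \<subseteq> tp_space"
    by (auto simp: tp_space_image closed_cell_def)
  have "quotient_map (top_of_set tmin_points) tp_topology (tp_class :: ereal ^ 'd \<Rightarrow> _)"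
    by (rule quotient_map_tp_class)
  then have "closedin (top_of_set tmin_points)
        {p \<in> tmin_points. tp_class p \<in> tp_class ` closed_cell Z I} \<longleftrightarrow>
      closedin tp_topology (tp_class ` closed_cell Z I)"
    unfolding quotient_map_closedin topspace_tp_topology topspace_euclidean_subtopology
    using sub by (elim conjE allE[of _ "tp_class ` closed_cell Z I"] impE)
  with closed show ?thesis
    by (simp add: sat)
qed

section \<open>The closure of a cell\<close>

lemma closed_cell_subset_closure:
  assumes "rel_cell Z I \<noteq> {}"
  shows "closed_cell Z I \<subseteq> closure (rel_cell Z I)"
proof
  fix p assume p: "p \<in> closed_cell Z I"
  obtain y where y: "y \<in> rel_cell Z I"
    using assms by blast
  have pt: "p \<in> tmin_points" and yt: "y \<in> tmin_points"
    using p y by (auto simp: rel_cell_def closed_cell_def)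
  define q where
    "q = (\<lambda>t::nat. \<chi> i. if p $ i = \<infinity> then y $ i + ereal (real t) else p $ i)"
  have lim: "q \<longlonglongrightarrow> p"
  proof (rule vec_tendstoI)
    fix i
    show "(\<lambda>t. q t $ i) \<longlonglongrightarrow> p $ i"
      using tendsto_add_ereal_PInfty[OF tmin_points_not_MInfty[OF yt, of i]]
      by (cases "p $ i = \<infinity>") (simp_all add: q_def)
  qed
  have "q t \<in> tmin_points" for t
    using pt yt by (force simp: q_def tmin_points_def tmin_def)
  \<comment> \<open>A coordinate of \<open>q t\<close> is infinite iff it is so in both
    \<open>p\<close> and \<open>y\<close>; \<open>y\<close> is infinite exactly on \<open>Z\<close>
    and \<open>p\<close> at least there.\<close>
  moreover have "{i. q t $ i = \<infinity>} = Z" for t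
    using p y by (auto simp: q_def rel_cell_def closed_cell_def split: if_splits)
  moreover have "\<forall>\<^sub>F t in sequentially. \<forall>j\<in>C. \<forall>i\<in>I j. \<forall>l. V l j \<noteq> \<infinity> \<longrightarrow>
      q t $ l \<le> q t $ i + ereal (real_of_ereal (V l j) - real_of_ereal (V i j))"
  proof (intro eventually_ball_finite ballI finite_columns finite eventually_all_finite)
    fix j i l
    assume j: "j \<in> C" and i: "i \<in> I j"
    define c where "c = real_of_ereal (V l j) - real_of_ereal (V i j)"
    have le: "p $ l \<le> p $ i + ereal c" "y $ l \<le> y $ i + ereal c" if "V l j \<noteq> \<infinity>"
      using p y i j that
      by (auto simp: rel_cell_def closed_cell_def covector_def c_def subset_iff)
    show "\<forall>\<^sub>F t in sequentially. V l j \<noteq> \<infinity> \<longrightarrow> q t $ l \<le> q t $ i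
        + ereal (real_of_ereal (V l j) - real_of_ereal (V i j))"
      unfolding c_def[symmetric]
    \<comment> \<open>Only for p_i infinite and p_l finite must t be large. Otherwise either both
      coordinates come from y + t and the inequality for \<open>y\<close> is shifted, or p_i is
      finite, which forces p_l to be finite, and both come from \<open>p\<close>.\<close>
    proof (cases "V l j \<noteq> \<infinity> \<and> p $ i = \<infinity> \<and> p $ l \<noteq> \<infinity>")
      case True
      have "(\<lambda>t. (y $ i + ereal c) + ereal (real t)) \<longlonglongrightarrow> \<infinity>"
        by (rule tendsto_add_ereal_PInfty) (use tmin_points_not_MInfty[OF yt, of i] in auto)
      then have "\<forall>\<^sub>F t in sequentially. p $ l < (y $ i + ereal c) + ereal (real t)"
        by (rule order_tendstoD) (use True in simp)
      then show "\<forall>\<^sub>F t in sequentially. V l j \<noteq> \<infinity> \<longrightarrow> q t $ l \<le> q t $ i + ereal c"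
        by eventually_elim (use True in \<open>simp add: q_def ac_simps\<close>)
    next
      case False
      have "q t $ l \<le> q t $ i + ereal c" if "V l j \<noteq> \<infinity>" for t
      proof (cases "p $ i = \<infinity>")
        case True
        then show ?thesis
          using False that le(2)[OF that] by (cases "y $ l"; cases "y $ i") (auto simp: q_def)
      next
        case fin: False
        then have "p $ l \<noteq> \<infinity>"
          using le(1)[OF that] by auto
        then show ?thesis
          using fin le(1)[OF that] by (simp add: q_def)
      qed
      then show "\<forall>\<^sub>F t in sequentially. V l j \<noteq> \<infinity> \<longrightarrow> q t $ l \<le> q t $ i + ereal c"
        by simp
    qed
  qed
  \<comment> \<open>Covector membership also asks for a finite entry in row i itself; the point
    \<open>y\<close> guarantees it.\<close>
  moreover have "V i j \<noteq> \<infinity>" if "j \<in> C" "i \<in> I j" for i j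
    using y that by (auto simp: rel_cell_def closed_cell_def covector_def)
  ultimately have "\<forall>\<^sub>F t in sequentially. q t \<in> rel_cell Z I"
    by (auto simp: rel_cell_def closed_cell_def covector_def subset_iff elim!: eventually_mono)
  then have "\<forall>\<^sub>F t in sequentially. q t \<in> closure (rel_cell Z I)"
    by eventually_elim (use closure_subset in blast)
  then show "p \<in> closure (rel_cell Z I)"
    using Lim_in_closed_set[OF closed_closure _ _ lim] by simp
qed

text \<open>One inclusion is minimality of the closure among closed sets. The other pushes the
  closure inside \<open>tmin_points\<close> forward along the continuous map
  \<open>tp_class\<close>.\<close>

lemma closure_of_rel_cell:
  assumes "rel_cell Z I \<noteq> {}"
  shows "tp_topology closure_of (tp_class ` rel_cell Z I) = tp_class ` closed_cell Z I"
proof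
  show "tp_topology closure_of (tp_class ` rel_cell Z I) \<subseteq> tp_class ` closed_cell Z I"
    by (intro closure_of_minimal closedin_closed_cell) (auto simp: rel_cell_def)
  have "rel_cell Z I \<subseteq> tmin_points"
    by (auto simp: rel_cell_def closed_cell_def)
  then have "closed_cell Z I \<subseteq> top_of_set tmin_points closure_of rel_cell Z I"
    using closed_cell_subset_closure[OF assms]
    by (auto simp: closure_of_subtopology Int_absorb1 closed_cell_def)
  then show "tp_class ` closed_cell Z I \<subseteq> tp_topology closure_of (tp_class ` rel_cell Z I)"
    using continuous_map_image_closure_subset[OF
        quotient_imp_continuous_map[OF quotient_map_tp_class], of "rel_cell Z I"]
    by blast
qed

section \<open>Intersections, covering and conclusion\<close>

lemma closed_cell_Int:
  "tp_class ` closed_cell Z I \<inter> tp_class ` closed_cell W J =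
   tp_class ` closed_cell (Z \<union> W) (\<lambda>j. I j \<union> J j)"
proof -
  have Int: "closed_cell (Z \<union> W) (\<lambda>j. I j \<union> J j) = closed_cell Z I \<inter> closed_cell W J"
    by (auto simp: closed_cell_def)
  show ?thesis
  proof (intro equalityI subsetI)
    fix x assume "x \<in> tp_class ` closed_cell Z I \<inter> tp_class ` closed_cell W J"
    then obtain p q where p: "p \<in> closed_cell Z I" and q: "q \<in> closed_cell W J"
      and x: "x = tp_class q" "tp_class p = tp_class q"
      by auto
    \<comment> \<open>The two cells may meet in a class through different representatives;
      saturation lets \<open>q\<close> serve for both.\<close>
    have "q \<in> closed_cell Z I"
      using p _ x(2) by (rule closed_cell_saturated) (use q in \<open>simp add: closed_cell_def\<close>)
    then show "x \<in> tp_class ` closed_cell (Z \<union> W) (\<lambda>j. I j \<union> J j)"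
      unfolding Int x(1) using q by simp
  qed (auto simp: Int)
qed

lemma closure_of_tp_covector_cell:
  assumes "A \<in> tp_covector_cells C V"
  obtains Z I where "tp_topology closure_of A = tp_class ` closed_cell Z I"
proof -
  obtain Z I where "rel_cell Z I \<noteq> {}" "A = tp_class ` rel_cell Z I"
    using assms unfolding tp_covector_cells_iff by blast
  then show thesis
    using that closure_of_rel_cell by simp
qed

lemma Union_tp_covector_cells: "\<Union>(tp_covector_cells C V) = tp_space"
proof
  show "\<Union>(tp_covector_cells C V) \<subseteq> tp_space"
  proof (rule Union_least)
    fix A assume "A \<in> tp_covector_cells C V"
    then obtain Z I where "A = tp_class ` rel_cell Z I"
      unfolding tp_covector_cells_iff by blast
    then show "A \<subseteq> tp_space"
      by (auto simp: tp_space_image rel_cell_def closed_cell_def)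
  qed
  \<comment> \<open>The closed cell without any condition is the whole space, so covering is a case
    of closed cells being unions of cells.\<close>
  have "tp_space = tp_class ` closed_cell {} (\<lambda>_. {})"
    by (simp add: tp_space_image closed_cell_def)
  then show "tp_space \<subseteq> \<Union>(tp_covector_cells C V)"
    using closed_cell_Union[of "{}" "\<lambda>_. {}"] Union_mono by metis
qed

theorem piecewise_linear_decomposition_tp_covector_cells:
  "piecewise_linear_decomposition (tp_covector_cells C V)"
  unfolding piecewise_linear_decomposition_def
proof (intro conjI ballI)
  fix A assume A: "A \<in> tp_covector_cells C V"
  then obtain Z I where A': "tp_topology closure_of A = tp_class ` closed_cell Z I"
    by (rule closure_of_tp_covector_cell)
  show "\<exists>\<D>\<subseteq>tp_covector_cells C V. tp_topology closure_of A = \<Union>\<D>"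
    unfolding A' by (rule closed_cell_Union)
  fix B assume "B \<in> tp_covector_cells C V"
  then obtain W J where B': "tp_topology closure_of B = tp_class ` closed_cell W J"
    by (rule closure_of_tp_covector_cell)
  show "\<exists>\<D>\<subseteq>tp_covector_cells C V.
      tp_topology closure_of A \<inter> tp_topology closure_of B = \<Union>\<D>"
    unfolding A' B' closed_cell_Int by (rule closed_cell_Union)
qed (use finite_tp_covector_cells stratum_polyhedron_tp_covector_cells Union_tp_covector_cells
    in auto)

end

theorem theorem50:
  fixes V :: "'d::finite \<Rightarrow> nat \<Rightarrow> ereal" and n :: nat
  assumes entries: "\<And>i j. j \<in> {1..n} \<Longrightarrow> V i j \<in> tmin"
    and columns: "\<And>j. j \<in> {1..n} \<Longrightarrow> \<exists>i. V i j \<noteq> \<infinity>"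
  shows "piecewise_linear_decomposition (tp_covector_cells {1..n} V)"
proof -
  interpret tropical_matrix V "{1..n}"
    using entries columns by unfold_locales (auto simp: tmin_def)
  show ?thesis
    by (rule piecewise_linear_decomposition_tp_covector_cells)
qed

end
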